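(* Let $\Phi:G\times Q\to Q$ be an action of a Lie group $G$ on a configuration manifold $Q$, with tangent-lifted action $T\Phi:G\times TQ\to TQ$. Given a $G$-equivariant one-step method $\Psi_h:TQ\to TQ$ and a $G$-invariant Lagrangian $L:TQ\to\mathbb{R}$, the associated shooting-based discrete Lagrangian $$L_d(q_0,q_1;h)=h\sum_{i=0}^n b_i L(q^i,v^i),\qquad (q^{i+1},v^{i+1})=\Psi_{(c_{i+1}-c_i)h}(q^i,v^i)\ \ (0\le i\le n-1),\quad q^0=q_0,\ q^n=q_1,$$ is $G$-invariant, i.e. $L_d(\Phi_g(q_0),\Phi_g(q_1);h)=L_d(q_0,q_1;h)$ for all $g\in G$.
   Context: The numbers $b_0,\dots,b_n$ are the weights and $0=c_0<c_1<\dots<c_{n-1}<c_n=1$ the nodes of a numerical quadrature formula $\int_0^h f(x)\,dx\approx h\sum_{i=0}^n b_i f(c_ih)$; weights may be zero. The one-step method is a family of maps $\Psi_h:TQ\to TQ$ indexed by the step size $h$. It is $G$-equivariant if $\Psi_h\circ T\Phi_g=T\Phi_g\circ\Psi_h$ for all $g\in G$ (and all step sizes $h$). The Lagrangian is $G$-invariant if $L\circ T\Phi_g=L$ for all $g\in G$. In the definition of $L_d$, the sequence $(q^i,v^i)_{i=0}^n$ is the solution of the discrete boundary-value (shooting) problem $(q^{i+1},v^{i+1})=\Psi_{(c_{i+1}-c_i)h}(q^i,v^i)$, $q^0=q_0$, $q^n=q_1$. It is implicit in the definition that this sequence is uniquely determined by $(q_0,q_1,h)$ for the arguments at which $L_d$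 is considered, so that $L_d$ is a well-defined function. *)

theory Defs
  imports "HOL-Analysis.Analysis" "HOL-Algebra.Group_Action"
begin

section \<open>Smooth maps on open subsets of normed spaces\<close>

text \<open>
  \<open>C_k_on k f S\<close> is meant for open \<open>S\<close>. On a finite-dimensional domain, \<open>C\<^sup>k\<close> is the same as being
  differentiable with all directional derivatives \<open>C\<^sup>k\<^sup>-\<^sup>1\<close>.
\<close>

fun C_k_on :: "nat \<Rightarrow> ('a::real_normed_vector \<Rightarrow> 'b::real_normed_vector) \<Rightarrow> 'a set \<Rightarrow> bool" where
  "C_k_on 0 f S \<longleftrightarrow> continuous_on S f"
| "C_k_on (Suc k) f S \<longleftrightarrow>
     (\<forall>x\<in>S. f differentiable (at x)) \<and>
     (\<forall>v. C_k_on k (\<lambda>x. frechet_derivative f (at x) v) S)"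

definition smooth_on :: "'a::real_normed_vector set \<Rightarrow> ('a \<Rightarrow> 'b::real_normed_vector) \<Rightarrow> bool" where
  "smooth_on S f \<longleftrightarrow> (\<forall>k. C_k_on k f S)"


section \<open>Smooth manifolds\<close>

text \<open>
  The model space \<open>'e\<close> is a finite-dimensional real inner product space. The class
  \<open>euclidean_space\<close> is not used because it excludes dimension zero, hence for instance
  discrete Lie groups. The atlas need not be maximal.
\<close>

record ('a, 'e) manifold =
  mtopology :: "'a topology"
  atlas :: "('a set \<times> ('a \<Rightarrow> 'e)) set"

abbreviation points :: "('a, 'e, 'm) manifold_scheme \<Rightarrow> 'a set" where
  "points M \<equiv> topspace (mtopology M)"

definition is_chart :: "'a topology \<Rightarrow> 'a set \<times> ('a \<Rightarrow> 'e::real_inner) \<Rightarrow> bool" where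
  "is_chart X = (\<lambda>(U, \<phi>). openin X U \<and> open (\<phi> ` U) \<and>
     homeomorphic_map (subtopology X U) (top_of_set (\<phi> ` U)) \<phi>)"

definition smooth_manifold :: "('a, 'e::real_inner) manifold \<Rightarrow> bool" where
  "smooth_manifold M \<longleftrightarrow>
     (\<exists>B :: 'e set. finite B \<and> span B = UNIV) \<and>
     Hausdorff_space (mtopology M) \<and> second_countable (mtopology M) \<and>
     (\<forall>\<kappa>\<in>atlas M. is_chart (mtopology M) \<kappa>) \<and>
     \<Union> (fst ` atlas M) = points M \<and>
     (\<forall>(U, \<phi>)\<in>atlas M. \<forall>(V, \<psi>)\<in>atlas M. smooth_on (\<phi> ` (U \<inter> V)) (\<psi> \<circ> inv_into U \<phi>))"

definition smooth_map ::
  "('a, 'e::real_inner) manifold \<Rightarrow> ('b, 'f::real_inner) manifold \<Rightarrow> ('a \<Rightarrow> 'b) \<Rightarrow> bool" where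
  "smooth_map M N F \<longleftrightarrow>
     continuous_map (mtopology M) (mtopology N) F \<and>
     (\<forall>(U, \<phi>)\<in>atlas M. \<forall>(V, \<psi>)\<in>atlas N.
        smooth_on (\<phi> ` (U \<inter> F -` V)) (\<psi> \<circ> F \<circ> inv_into U \<phi>))"

definition prod_manifold ::
  "('a, 'e) manifold \<Rightarrow> ('b, 'f) manifold \<Rightarrow> ('a \<times> 'b, 'e \<times> 'f) manifold" where
  "prod_manifold M N =
     \<lparr>mtopology = prod_topology (mtopology M) (mtopology N),
      atlas = {(U \<times> V, map_prod \<phi> \<psi>) | U \<phi> V \<psi>. (U, \<phi>) \<in> atlas M \<and> (V, \<psi>) \<in> atlas N}\<rparr>"


section \<open>Tangent bundle\<close>

text \<open>
  Tangent vectors at \<open>p\<close> are the derivations at \<open>p\<close> of the algebra of smooth real functions.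
  Functions on the manifold and functionals on that algebra are extensional, so that
  equality of tangent vectors is equality in HOL.
\<close>

definition smooth_functions :: "('a, 'e::real_inner) manifold \<Rightarrow> ('a \<Rightarrow> real) set" where
  "smooth_functions M =
     {f \<in> extensional (points M). \<forall>(U, \<phi>)\<in>atlas M. smooth_on (\<phi> ` U) (f \<circ> inv_into U \<phi>)}"

definition tangent_space ::
  "('a, 'e::real_inner) manifold \<Rightarrow> 'a \<Rightarrow> (('a \<Rightarrow> real) \<Rightarrow> real) set" where
  "tangent_space M p =
     {X \<in> extensional (smooth_functions M).
        (\<forall>f\<in>smooth_functions M. \<forall>g\<in>smooth_functions M. \<forall>a b.
           X (\<lambda>x\<in>points M. a * f x + b * g x) = a * X f + b * X g) \<and>
        (\<forall>f\<in>smooth_functions M. \<forall>g\<in>smooth_functions M.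
           X (\<lambda>x\<in>points M. f x * g x) = f p * X g + g p * X f)}"

type_synonym 'a tangent_vector = "'a \<times> (('a \<Rightarrow> real) \<Rightarrow> real)"

definition tangent_bundle :: "('a, 'e::real_inner) manifold \<Rightarrow> 'a tangent_vector set" where
  "tangent_bundle M = (SIGMA p:points M. tangent_space M p)"

definition tangent_map ::
  "('a, 'e::real_inner) manifold \<Rightarrow> ('b, 'f::real_inner) manifold \<Rightarrow> ('a \<Rightarrow> 'b) \<Rightarrow>
     'a tangent_vector \<Rightarrow> 'b tangent_vector" where
  "tangent_map M N F =
     (\<lambda>(p, X). (F p, \<lambda>f\<in>smooth_functions N. X (\<lambda>x\<in>points M. f (F x))))"


section \<open>Lie groups and their actions\<close>

definition lie_group :: "'g monoid \<Rightarrow> ('g, 'e::real_inner) manifold \<Rightarrow> bool" where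
  "lie_group G M \<longleftrightarrow>
     group G \<and> smooth_manifold M \<and> points M = carrier G \<and>
     smooth_map (prod_manifold M M) M (\<lambda>(x, y). x \<otimes>\<^bsub>G\<^esub> y) \<and>
     smooth_map M M (\<lambda>x. inv\<^bsub>G\<^esub> x)"

definition lie_group_action ::
  "'g monoid \<Rightarrow> ('g, 'd::real_inner) manifold \<Rightarrow> ('q, 'e::real_inner) manifold \<Rightarrow>
     ('g \<Rightarrow> 'q \<Rightarrow> 'q) \<Rightarrow> bool" where
  "lie_group_action G M Q \<Phi> \<longleftrightarrow>
     group_action G (points Q) \<Phi> \<and>
     smooth_map (prod_manifold M Q) Q (\<lambda>(g, q). \<Phi> g q)"


section \<open>One-step methods, Lagrangians and the shooting-based discrete Lagrangian\<close>

text \<open>\<open>H\<close> is the set of admissible step sizes, for instance all positive reals or all reals.\<close>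

definition one_step_method ::
  "('q, 'e::real_inner) manifold \<Rightarrow> real set \<Rightarrow>
     (real \<Rightarrow> 'q tangent_vector \<Rightarrow> 'q tangent_vector) \<Rightarrow> bool" where
  "one_step_method Q H \<Psi> \<longleftrightarrow> (\<forall>h\<in>H. \<Psi> h \<in> tangent_bundle Q \<rightarrow> tangent_bundle Q)"

definition equivariant_method ::
  "'g monoid \<Rightarrow> ('q, 'e::real_inner) manifold \<Rightarrow> ('g \<Rightarrow> 'q \<Rightarrow> 'q) \<Rightarrow> real set \<Rightarrow>
     (real \<Rightarrow> 'q tangent_vector \<Rightarrow> 'q tangent_vector) \<Rightarrow> bool" where
  "equivariant_method G Q \<Phi> H \<Psi> \<longleftrightarrow>
     (\<forall>g\<in>carrier G. \<forall>h\<in>H. \<forall>w\<in>tangent_bundle Q.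
        \<Psi> h (tangent_map Q Q (\<Phi> g) w) = tangent_map Q Q (\<Phi> g) (\<Psi> h w))"

definition invariant_lagrangian ::
  "'g monoid \<Rightarrow> ('q, 'e::real_inner) manifold \<Rightarrow> ('g \<Rightarrow> 'q \<Rightarrow> 'q) \<Rightarrow>
     ('q tangent_vector \<Rightarrow> real) \<Rightarrow> bool" where
  "invariant_lagrangian G Q \<Phi> L \<longleftrightarrow>
     (\<forall>g\<in>carrier G. \<forall>w\<in>tangent_bundle Q. L (tangent_map Q Q (\<Phi> g) w) = L w)"

text \<open>The pair \<open>(q\<^sup>i, v\<^sup>i)\<close> is the single element \<open>w i\<close> of the tangent bundle.\<close>

definition shooting_solution ::
  "('q, 'e::real_inner) manifold \<Rightarrow> (real \<Rightarrow> 'q tangent_vector \<Rightarrow> 'q tangent_vector) \<Rightarrow>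
     nat \<Rightarrow> (nat \<Rightarrow> real) \<Rightarrow> 'q \<Rightarrow> 'q \<Rightarrow> real \<Rightarrow> (nat \<Rightarrow> 'q tangent_vector) \<Rightarrow> bool" where
  "shooting_solution Q \<Psi> n c q0 q1 h w \<longleftrightarrow>
     w \<in> {..n} \<rightarrow>\<^sub>E tangent_bundle Q \<and>
     (\<forall>i<n. w (Suc i) = \<Psi> ((c (Suc i) - c i) * h) (w i)) \<and>
     fst (w 0) = q0 \<and> fst (w n) = q1"

definition discrete_lagrangian ::
  "('q, 'e::real_inner) manifold \<Rightarrow> (real \<Rightarrow> 'q tangent_vector \<Rightarrow> 'q tangent_vector) \<Rightarrow>
     ('q tangent_vector \<Rightarrow> real) \<Rightarrow> nat \<Rightarrow> (nat \<Rightarrow> real) \<Rightarrow> (nat \<Rightarrow> real) \<Rightarrow>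
     'q \<Rightarrow> 'q \<Rightarrow> real \<Rightarrow> real" where
  "discrete_lagrangian Q \<Psi> L n b c q0 q1 h =
     (let w = (THE w. shooting_solution Q \<Psi> n c q0 q1 h w)
      in h * (\<Sum>i\<le>n. b i * L (w i)))"

end

theory Submission
  imports Defs
begin

text \<open>
  Since \<open>\<Phi>\<^sub>g\<close> is smooth with inverse \<open>\<Phi>\<^bsub>inv g\<^esub>\<close>, the tangent map \<open>T\<Phi>\<^sub>g\<close> is a bijection of \<open>TQ\<close>
  with inverse \<open>T\<Phi>\<^bsub>inv g\<^esub>\<close>. By equivariance, applying \<open>T\<Phi>\<^sub>g\<close> pointwise is a bijection from the
  solutions of the shooting problem for \<open>(q\<^sub>0, q\<^sub>1)\<close> to those for \<open>(\<Phi>\<^sub>g q\<^sub>0, \<Phi>\<^sub>g q\<^sub>1)\<close>. So the latter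
  problem is uniquely solvable too, by the translated solution, and \<open>L\<close> takes the same values
  along both. The analytic content is that \<open>T\<Phi>\<^sub>g\<close> maps derivations to derivations, which rests on
  the chain rule for \<open>C\<^sup>k\<close> maps.
\<close>

section \<open>Calculus of \<open>C\<^sup>k\<close> maps\<close>

text \<open>A derivative depends only on the values near the point, so agreement on an open set
  passes to all directional derivatives.\<close>

lemma C_k_on_cong:
  assumes "C_k_on k f S" "open S" "\<And>x. x \<in> S \<Longrightarrow> f x = g x"
  shows "C_k_on k g S"
  using assms(1,3)
proof (induction k arbitrary: f g)
  case 0
  then show ?case by (auto cong: continuous_on_cong)
next
  case (Suc k)
  have der: "(g has_derivative frechet_derivative f (at x)) (at x)" if "x \<in> S" for x
    using Suc.prems that \<open>open S\<close>
    by (auto intro: has_derivative_transform_within_open simp: frechet_derivative_works)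
  then have "frechet_derivative g (at x) = frechet_derivative f (at x)" if "x \<in> S" for x
    using frechet_derivative_at that by metis
  then have "C_k_on k (\<lambda>x. frechet_derivative g (at x) v) S" for v
    using Suc.prems by (simp add: Suc.IH[of "\<lambda>x. frechet_derivative f (at x) v"])
  then show ?case
    using der by (auto simp: differentiable_def)
qed

text \<open>Used where no single chart of the target need cover the image of a chart of the
  source.\<close>

lemma C_k_on_local:
  assumes "\<And>x. x \<in> S \<Longrightarrow> \<exists>T. open T \<and> x \<in> T \<and> C_k_on k f T"
  shows "C_k_on k f S"
  using assms
proof (induction k arbitrary: f)
  case 0
  then show ?case
    by (auto intro!: continuous_at_imp_continuous_on simp: continuous_on_eq_continuous_at)
      (metis continuous_on_eq_continuous_at)
next
  case (Suc k)
  have "f differentiable (at x)" if "x \<in> S" for x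
    using Suc.prems[OF that] by auto
  moreover have "C_k_on k (\<lambda>x. frechet_derivative f (at x) v) S" for v
    using Suc.prems by (intro Suc.IH) (metis C_k_on.simps(2))
  ultimately show ?case by simp
qed

lemma C_k_on_SucD:
  assumes "C_k_on (Suc k) f S"
  shows "C_k_on k f S"
  using assms
proof (induction k arbitrary: f)
  case 0
  then show ?case
    by (auto intro!: continuous_at_imp_continuous_on differentiable_imp_continuous_within)
next
  case (Suc k)
  then show ?case by (metis C_k_on.simps(2))
qed

text \<open>\<open>frechet_derivative\<close> is a choice; by uniqueness of derivatives any explicit
  family \<open>D\<close> may stand in for it. The inductions on \<open>k\<close> below reach their
  successor case through this rule.\<close>

lemma C_k_on_SucI:
  assumes "open S"
    and "\<And>x. x \<in> S \<Longrightarrow> (f has_derivative D x) (at x)"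
    and "\<And>v. C_k_on k (\<lambda>x. D x v) S"
  shows "C_k_on (Suc k) f S"
proof -
  have "D x = frechet_derivative f (at x)" if "x \<in> S" for x
    using assms(2)[OF that] by (rule frechet_derivative_at)
  then have "C_k_on k (\<lambda>x. frechet_derivative f (at x) v) S" for v
    by (intro C_k_on_cong[OF assms(3)[of v] assms(1)]) simp
  then show ?thesis
    using assms(2) by (auto simp: differentiable_def)
qed

lemma C_k_on_Suc_has_derivative:
  assumes "C_k_on (Suc k) f S" "x \<in> S"
  shows "(f has_derivative frechet_derivative f (at x)) (at x)"
  using assms by (simp add: frechet_derivative_works)

lemma C_k_on_const:
  assumes "open S"
  shows "C_k_on k (\<lambda>x. a) S"
proof (induction k arbitrary: a)
  case (Suc k)
  then show ?case
    by (intro C_k_on_SucI[where D = "\<lambda>x v. 0"]) (auto intro: assms)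
qed simp

lemma C_k_on_add:
  assumes "open S" "C_k_on k f S" "C_k_on k g S"
  shows "C_k_on k (\<lambda>x. f x + g x) S"
  using assms(2,3)
proof (induction k arbitrary: f g)
  case (Suc k)
  show ?case
    by (rule C_k_on_SucI[OF assms(1)],
        rule has_derivative_add[OF C_k_on_Suc_has_derivative[OF Suc.prems(1)]
          C_k_on_Suc_has_derivative[OF Suc.prems(2)]])
      (use Suc in auto)
qed (auto intro: continuous_intros)

lemma C_k_on_sum:
  assumes "open S" "\<And>i. i \<in> I \<Longrightarrow> C_k_on k (f i) S"
  shows "C_k_on k (\<lambda>x. \<Sum>i\<in>I. f i x) S"
  using assms(2)
  by (induction I rule: infinite_finite_induct)
    (simp_all add: C_k_on_const C_k_on_add assms(1))

lemma C_k_on_scaleR: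
  assumes "open S" "C_k_on k r S" "C_k_on k f S"
  shows "C_k_on k (\<lambda>x. r x *\<^sub>R f x) S"
  using assms(2,3)
proof (induction k arbitrary: r f)
  case (Suc k)
  \<comment> \<open>The product rule leaves one factor undifferentiated in each term, so both
    factors are also wanted at order \<open>k\<close>.\<close>
  have "C_k_on k r S" "C_k_on k f S"
    using Suc.prems by (auto intro: C_k_on_SucD simp del: C_k_on.simps)
  then have "C_k_on k (\<lambda>x. r x *\<^sub>R frechet_derivative f (at x) v
      + frechet_derivative r (at x) v *\<^sub>R f x) S" for v
    using Suc by (intro C_k_on_add assms(1)) auto
  with C_k_on_SucI[OF assms(1) has_derivative_scaleR[OF
      C_k_on_Suc_has_derivative[OF Suc.prems(1)] C_k_on_Suc_has_derivative[OF Suc.prems(2)]]]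
  show ?case by blast
qed (auto intro: continuous_intros)

lemma C_k_on_mult:
  fixes f g :: "_ \<Rightarrow> real"
  assumes "open S" "C_k_on k f S" "C_k_on k g S"
  shows "C_k_on k (\<lambda>x. f x * g x) S"
  using C_k_on_scaleR[OF assms] by simp

lemma C_k_on_bounded_linear:
  assumes "bounded_linear h" "open S" "C_k_on k f S"
  shows "C_k_on k (\<lambda>x. h (f x)) S"
  using assms(3)
proof (induction k arbitrary: f)
  case 0
  then show ?case
    using bounded_linear.continuous_on[OF assms(1)] by auto
next
  case (Suc k)
  show ?case
    by (rule C_k_on_SucI[OF assms(2)],
        rule bounded_linear.has_derivative[OF assms(1) C_k_on_Suc_has_derivative[OF Suc.prems]])
      (use Suc in auto)
qed

text \<open>The remainder of \<open>x\<close> after projection lies in the span of \<open>C\<close>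
  and is orthogonal to it, hence to itself, hence zero. \<open>C\<close> may contain 0: division by
  zero makes that coefficient 0.\<close>

lemma orthogonal_expansion:
  fixes C :: "'a::real_inner set"
  assumes "finite C" "pairwise orthogonal C" "x \<in> span C"
  shows "x = (\<Sum>c\<in>C. ((x \<bullet> c) / (c \<bullet> c)) *\<^sub>R c)"
proof -
  define y where "y = x - (\<Sum>c\<in>C. ((c \<bullet> x) / (c \<bullet> c)) *\<^sub>R c)"
  have "y \<in> span C"
    unfolding y_def using assms(3) by (intro span_diff span_sum span_scale) (auto intro: span_base)
  moreover have "orthogonal y c" if "c \<in> C" for c
  proof -
    have "(\<Sum>d\<in>C. ((d \<bullet> x) / (d \<bullet> d)) * (d \<bullet> c)) = (\<Sum>d\<in>C. if d = c then c \<bullet> x else 0)"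
      using assms(2) that by (intro sum.cong) (auto simp: pairwise_def orthogonal_def)
    then show ?thesis
      using assms(1) that
      by (simp add: y_def orthogonal_def inner_diff_left inner_sum_left inner_commute[of x c])
  qed
  ultimately have "orthogonal y y"
    using orthogonal_to_span by blast
  then show ?thesis
    by (simp add: y_def orthogonal_self inner_commute)
qed

text \<open>The derivative of \<open>F\<close> is \<open>C\<^sup>k\<close> only in each fixed direction, while the chain rule evaluates it in
  the direction \<open>G' x v\<close>, which varies with \<open>x\<close>. Expanding this direction in an orthogonal basis
  reduces to fixed directions, whence the assumption of finite dimension.\<close>

lemma C_k_on_compose:
  fixes F :: "'b::real_inner \<Rightarrow> 'c::real_normed_vector"
    and G :: "'a::real_normed_vector \<Rightarrow> 'b"
  assumes "finite B" "span B = (UNIV :: 'b set)"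
    and "open S" "G ` S \<subseteq> T" "C_k_on k G S" "C_k_on k F T"
  shows "C_k_on k (\<lambda>x. F (G x)) S"
proof -
  obtain C :: "'b set" where C: "finite C" "span C = UNIV" "pairwise orthogonal C"
    using basis_orthogonal[OF assms(1)] assms(2) by metis
  show ?thesis
    using assms(5,6)
  proof (induction k arbitrary: F)
    case 0
    then show ?case
      using assms(4) by (auto intro: continuous_on_compose2)
  next
    case (Suc k)
    let ?G' = "\<lambda>x. frechet_derivative G (at x)" and ?F' = "\<lambda>y. frechet_derivative F (at y)"
    have G: "C_k_on k G S"
      using Suc.prems(1) by (rule C_k_on_SucD)
    have G': "C_k_on k (\<lambda>x. ?G' x v) S" for v
      using Suc.prems(1) by simp
    \<comment> \<open>The induction hypothesis is applied to a derivative of \<open>F\<close> in a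
      fixed direction, with the same inner map; hence \<open>F\<close> is generalised and
      \<open>G\<close> is not.\<close>
    have F': "C_k_on k (\<lambda>x. ?F' (G x) v) S" for v
      using Suc.prems(2) by (intro Suc.IH[where F = "\<lambda>y. ?F' y v"] G) simp
    have der: "((\<lambda>x. F (G x)) has_derivative (\<lambda>v. ?F' (G x) (?G' x v))) (at x)" if "x \<in> S" for x
      using that assms(4) Suc.prems
      by (intro has_derivative_compose[of G _ x UNIV F] C_k_on_Suc_has_derivative) auto
    have lin: "linear (?F' (G x))" if "x \<in> S" for x
      using that assms(4) Suc.prems(2) by (auto intro!: linear_frechet_derivative)
    have expand: "?F' (G x) (?G' x v) = (\<Sum>c\<in>C. ((?G' x v \<bullet> c) / (c \<bullet> c)) *\<^sub>R ?F' (G x) c)"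
      if "x \<in> S" for x v
      using arg_cong[where f = "?F' (G x)", OF orthogonal_expansion[OF C(1,3), of "?G' x v"]]
      by (simp add: C(2) linear_sum[OF lin[OF that]] linear_scale[OF lin[OF that]])
    have "C_k_on k (\<lambda>x. \<Sum>c\<in>C. ((?G' x v \<bullet> c) / (c \<bullet> c)) *\<^sub>R ?F' (G x) c) S" for v
      by (intro C_k_on_sum C_k_on_scaleR assms(3) F'
          C_k_on_bounded_linear[OF _ assms(3) G', where h = "\<lambda>u. (u \<bullet> c) / (c \<bullet> c)" for c]
          bounded_linear_compose[OF bounded_linear_divide bounded_linear_inner_left])
    then have "C_k_on k (\<lambda>x. ?F' (G x) (?G' x v)) S" for v
      by (rule C_k_on_cong[OF _ assms(3)]) (rule expand[symmetric])
    with der show ?case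
      by (intro C_k_on_SucI[OF assms(3)])
  qed
qed

text \<open>The map \<open>Pair a\<close> has derivative \<open>(0, v)\<close> in direction
  \<open>v\<close> at every point. Only fixed directions of \<open>F\<close> occur, so no basis
  expansion enters.\<close>

lemma C_k_on_slice:
  fixes F :: "'a::real_normed_vector \<times> 'b::real_normed_vector \<Rightarrow> 'c::real_normed_vector"
  assumes "open S" "Pair a ` S \<subseteq> T" "C_k_on k F T"
  shows "C_k_on k (\<lambda>x. F (a, x)) S"
  using assms(3)
proof (induction k arbitrary: F)
  case 0
  then show ?case
    using assms(2)
    by (auto intro!: continuous_on_compose2[of T F S "Pair a"] continuous_intros)
next
  case (Suc k)
  let ?F' = "\<lambda>y. frechet_derivative F (at y)"
  have "((\<lambda>x. F (a, x)) has_derivative (\<lambda>v. ?F' (a, x) (0, v))) (at x)" if "x \<in> S" for x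
    using that assms(2) Suc.prems
    by (intro has_derivative_compose[of "Pair a" _ x UNIV F] C_k_on_Suc_has_derivative
        has_derivative_Pair has_derivative_const has_derivative_ident) auto
  moreover have "C_k_on k (\<lambda>x. ?F' (a, x) (0, v)) S" for v
    using Suc.prems by (intro Suc.IH[where F = "\<lambda>y. ?F' y (0, v)"]) simp
  ultimately show ?case
    by (intro C_k_on_SucI[OF assms(1)])
qed

section \<open>Smooth maps between manifolds\<close>

text \<open>For the last claim: a chart is a homeomorphism onto an open set of the model space,
  hence open as a map into the whole space. This makes the domains of coordinate expressions
  open.\<close>

lemma smooth_manifold_chart:
  assumes "smooth_manifold M" "(U, \<phi>) \<in> atlas M"
  shows "openin (mtopology M) U" "open (\<phi> ` U)" "inj_on \<phi> U" "U \<subseteq> points M"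
    and "\<And>V. openin (mtopology M) V \<Longrightarrow> open (\<phi> ` (U \<inter> V))"
proof -
  have U: "openin (mtopology M) U" "open (\<phi> ` U)"
    and hom: "homeomorphic_map (subtopology (mtopology M) U) (top_of_set (\<phi> ` U)) \<phi>"
    using assms by (auto simp: smooth_manifold_def is_chart_def)
  then show "openin (mtopology M) U" "open (\<phi> ` U)" "U \<subseteq> points M"
    by (auto dest: openin_subset)
  then show "inj_on \<phi> U"
    using homeomorphic_imp_injective_map[OF hom] by (simp add: Int_absorb1)
  fix V assume "openin (mtopology M) V"
  then have "openin (subtopology (mtopology M) U) (U \<inter> V)"
    by (auto simp: openin_subtopology_Int2)
  then have "openin (top_of_set (\<phi> ` U)) (\<phi> ` (U \<inter> V))"
    using homeomorphic_imp_open_map[OF hom] by (auto simp: open_map_def)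
  then show "open (\<phi> ` (U \<inter> V))"
    using U(2) by (metis openin_open_trans)
qed

lemma smooth_manifold_chart_exists:
  assumes "smooth_manifold M" "p \<in> points M"
  obtains U \<phi> where "(U, \<phi>) \<in> atlas M" "p \<in> U"
proof -
  have "p \<in> \<Union> (fst ` atlas M)"
    using assms by (simp add: smooth_manifold_def)
  then show ?thesis
    using that by auto
qed

lemma smooth_map_points:
  assumes "smooth_map M N F" "p \<in> points M"
  shows "F p \<in> points N"
  using assms by (auto simp: smooth_map_def dest: continuous_map_image_subset_topspace)

lemma smooth_map_C_k_on:
  assumes "smooth_map M N F" "(U, \<phi>) \<in> atlas M" "(V, \<psi>) \<in> atlas N"
  shows "C_k_on k (\<psi> \<circ> F \<circ> inv_into U \<phi>) (\<phi> ` (U \<inter> F -` V))"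
proof -
  have "\<forall>(U, \<phi>)\<in>atlas M. \<forall>(V, \<psi>)\<in>atlas N.
      smooth_on (\<phi> ` (U \<inter> F -` V)) (\<psi> \<circ> F \<circ> inv_into U \<phi>)"
    using assms(1) by (simp add: smooth_map_def)
  then show ?thesis
    using assms(2,3) by (fastforce simp: smooth_on_def)
qed

text \<open>Near each point, the pullback in coordinates is the coordinate expression of
  \<open>f\<close> after that of \<open>F\<close>, so the chain rule applies.\<close>

lemma smooth_functions_pullback:
  assumes M: "smooth_manifold M" and N: "smooth_manifold N"
    and F: "smooth_map M N F" and f: "f \<in> smooth_functions N"
  shows "(\<lambda>x\<in>points M. f (F x)) \<in> smooth_functions M"
proof -
  have "C_k_on k ((\<lambda>x\<in>points M. f (F x)) \<circ> inv_into U \<phi>) (\<phi> ` U)" if U: "(U, \<phi>) \<in> atlas M" for k U \<phi>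
  proof (rule C_k_on_local)
    fix y assume "y \<in> \<phi> ` U"
    then obtain p where p: "p \<in> U" "y = \<phi> p" by auto
    note chU = smooth_manifold_chart[OF M U]
    have "F p \<in> points N"
      using p chU(4) F by (auto intro: smooth_map_points)
    then obtain V \<psi> where V: "(V, \<psi>) \<in> atlas N" "F p \<in> V"
      using smooth_manifold_chart_exists[OF N] by metis
    note chV = smooth_manifold_chart[OF N V(1)]
    obtain B :: "'d set" where B: "finite B" "span B = UNIV"
      using N by (auto simp: smooth_manifold_def)
    \<comment> \<open>The part of the chart \<open>U\<close> that \<open>F\<close> sends into
      \<open>V\<close>, in coordinates; it is open because \<open>F\<close> is continuous.\<close>
    define T where "T = \<phi> ` (U \<inter> F -` V)"
    have "openin (mtopology M) {x \<in> points M. F x \<in> V}"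
      using F chV(1) by (auto simp: smooth_map_def intro: openin_continuous_map_preimage)
    moreover have "U \<inter> F -` V = U \<inter> {x \<in> points M. F x \<in> V}"
      using chU(4) by auto
    ultimately have T: "open T"
      unfolding T_def using chU(5) by metis
    have G: "C_k_on k (\<psi> \<circ> F \<circ> inv_into U \<phi>) T"
      unfolding T_def by (rule smooth_map_C_k_on[OF F U V(1)])
    have f': "C_k_on k (f \<circ> inv_into V \<psi>) (\<psi> ` V)"
      using f V(1) by (auto simp: smooth_functions_def smooth_on_def)
    have "C_k_on k (\<lambda>x. (f \<circ> inv_into V \<psi>) ((\<psi> \<circ> F \<circ> inv_into U \<phi>) x)) T"
      by (rule C_k_on_compose[OF B T _ G f']) (auto simp: T_def inv_into_f_f[OF chU(3)])
    \<comment> \<open>On \<open>T\<close> the chart \<open>\<psi>\<close> and its inverse cancel,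
      because \<open>F\<close> takes values in \<open>V\<close> there.\<close>
    then have "C_k_on k ((\<lambda>x\<in>points M. f (F x)) \<circ> inv_into U \<phi>) T"
      by (rule C_k_on_cong[OF _ T])
        (use chU(4) in \<open>auto simp: T_def inv_into_f_f[OF chU(3)] inv_into_f_f[OF chV(3)]\<close>)
    moreover have "y \<in> T"
      using p V by (auto simp: T_def)
    ultimately show "\<exists>T. open T \<and> y \<in> T \<and> C_k_on k ((\<lambda>x\<in>points M. f (F x)) \<circ> inv_into U \<phi>) T"
      using T by blast
  qed
  then show ?thesis
    by (auto simp: smooth_functions_def smooth_on_def)
qed

section \<open>The algebra of smooth functions\<close>

lemma smooth_functionsI:
  assumes M: "smooth_manifold M"
    and "\<And>k U \<phi>. (U, \<phi>) \<in> atlas M \<Longrightarrow> C_k_on k (\<lambda>y. f (inv_into U \<phi> y)) (\<phi> ` U)"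
  shows "(\<lambda>x\<in>points M. f x) \<in> smooth_functions M"
proof -
  have "C_k_on k ((\<lambda>x\<in>points M. f x) \<circ> inv_into U \<phi>) (\<phi> ` U)" if U: "(U, \<phi>) \<in> atlas M" for k U \<phi>
    using smooth_manifold_chart[OF M U]
    by (intro C_k_on_cong[OF assms(2)[OF U]]) auto
  then show ?thesis
    by (auto simp: smooth_functions_def smooth_on_def)
qed

lemma smooth_functions_C_k_on:
  assumes "f \<in> smooth_functions M" "(U, \<phi>) \<in> atlas M"
  shows "C_k_on k (\<lambda>y. f (inv_into U \<phi> y)) (\<phi> ` U)"
  using assms by (auto simp: smooth_functions_def smooth_on_def comp_def)

text \<open>Tangent vectors are \<open>undefined\<close> off the smooth functions, so a
  pushed-forward vector can be evaluated on a combination only once that combination is known to be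
  smooth.\<close>

lemma smooth_functions_linear_combination:
  assumes M: "smooth_manifold M" and "f \<in> smooth_functions M" "g \<in> smooth_functions M"
  shows "(\<lambda>x\<in>points M. a * f x + b * g x) \<in> smooth_functions M"
proof (rule smooth_functionsI[OF M])
  fix k U \<phi> assume U: "(U, \<phi>) \<in> atlas M"
  note op = smooth_manifold_chart(2)[OF M U]
  show "C_k_on k (\<lambda>y. a * f (inv_into U \<phi> y) + b * g (inv_into U \<phi> y)) (\<phi> ` U)"
    using assms(2,3) U
    by (intro C_k_on_add[OF op] C_k_on_mult[OF op C_k_on_const[OF op]] smooth_functions_C_k_on)
qed

lemma smooth_functions_mult:
  assumes M: "smooth_manifold M" and "f \<in> smooth_functions M" "g \<in> smooth_functions M"
  shows "(\<lambda>x\<in>points M. f x * g x) \<in> smooth_functions M"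
proof (rule smooth_functionsI[OF M])
  fix k U \<phi> assume U: "(U, \<phi>) \<in> atlas M"
  show "C_k_on k (\<lambda>y. f (inv_into U \<phi> y) * g (inv_into U \<phi> y)) (\<phi> ` U)"
    using assms(2,3) U by (intro C_k_on_mult[OF smooth_manifold_chart(2)[OF M U]] smooth_functions_C_k_on)
qed

text \<open>In a product chart around \<open>g\<close>, the coordinate expression of
  \<open>F g\<close> is that of \<open>F\<close> with the first coordinate frozen at
  \<open>\<theta> g\<close>. This extracts smoothness of each \<open>\<Phi> g\<close> from joint
  smoothness of the action.\<close>

lemma smooth_map_slice:
  assumes M: "smooth_manifold M" and Q: "smooth_manifold Q" and N: "smooth_manifold N"
    and F: "smooth_map (prod_manifold M Q) N (\<lambda>(g, q). F g q)" and g: "g \<in> points M"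
  shows "smooth_map Q N (F g)"
proof -
  have "continuous_map (mtopology Q) (mtopology N) ((\<lambda>(g, q). F g q) \<circ> Pair g)"
    using F g
    by (intro continuous_map_compose[of _ "prod_topology (mtopology M) (mtopology Q)"]
        continuous_map_pairedI)
      (auto simp: smooth_map_def prod_manifold_def)
  then have cont: "continuous_map (mtopology Q) (mtopology N) (F g)"
    by (simp add: comp_def)
  have "C_k_on k (\<psi> \<circ> F g \<circ> inv_into U \<phi>) (\<phi> ` (U \<inter> F g -` V))"
    if U: "(U, \<phi>) \<in> atlas Q" and V: "(V, \<psi>) \<in> atlas N" for k U \<phi> V \<psi>
  proof -
    obtain W \<theta> where W: "(W, \<theta>) \<in> atlas M" "g \<in> W"
      using smooth_manifold_chart_exists[OF M g] by metis
    note chU = smooth_manifold_chart[OF Q U] and chW = smooth_manifold_chart[OF M W(1)]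
    have inj: "inj_on (map_prod \<theta> \<phi>) (W \<times> U)"
      using chU(3) chW(3) by (rule map_prod_inj_on[rotated])
    have "openin (mtopology Q) {x \<in> points Q. F g x \<in> V}"
      using cont smooth_manifold_chart(1)[OF N V] by (rule openin_continuous_map_preimage)
    moreover have "U \<inter> F g -` V = U \<inter> {x \<in> points Q. F g x \<in> V}"
      using chU(4) by auto
    ultimately have op: "open (\<phi> ` (U \<inter> F g -` V))"
      using chU(5) by metis
    have "(W \<times> U, map_prod \<theta> \<phi>) \<in> atlas (prod_manifold M Q)"
      using U W by (auto simp: prod_manifold_def)
    note smooth = smooth_map_C_k_on[OF F this V, of k]
    have inv: "inv_into (W \<times> U) (map_prod \<theta> \<phi>) (\<theta> g, \<phi> q) = (g, q)" if "q \<in> U" for q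
      using inv_into_f_f[OF inj, of "(g, q)"] that W(2) by simp
    show ?thesis
      by (rule C_k_on_cong[OF C_k_on_slice[OF op _ smooth, where a = "\<theta> g"] op])
        (use W(2) in \<open>auto simp: inv inv_into_f_f[OF chU(3)] intro!: image_eqI[where x = "(g, q)" for q]\<close>)
  qed
  with cont show ?thesis
    by (auto simp: smooth_map_def smooth_on_def)
qed

section \<open>Tangent maps\<close>

text \<open>Pullback along \<open>F\<close> is a homomorphism of function algebras, so precomposing
  with it turns a derivation at \<open>p\<close> into one at \<open>F p\<close>.\<close>

lemma tangent_map_in_tangent_bundle:
  assumes M: "smooth_manifold M" and N: "smooth_manifold N"
    and F: "smooth_map M N F" and w: "w \<in> tangent_bundle M"
  shows "tangent_map M N F w \<in> tangent_bundle N"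
proof -
  obtain p X where w_eq: "w = (p, X)" and p: "p \<in> points M" and X: "X \<in> tangent_space M p"
    using w by (auto simp: tangent_bundle_def)
  note pull = smooth_functions_pullback[OF M N F]
  have Xlin: "X (\<lambda>x\<in>points M. a * f x + b * g x) = a * X f + b * X g"
    and Xprod: "X (\<lambda>x\<in>points M. f x * g x) = f p * X g + g p * X f"
    if "f \<in> smooth_functions M" "g \<in> smooth_functions M" for f g a b
    using X that by (auto simp: tangent_space_def)
  let ?Y = "\<lambda>f\<in>smooth_functions N. X (\<lambda>x\<in>points M. f (F x))"
  have lin: "?Y (\<lambda>x\<in>points N. a * f x + b * g x) = a * ?Y f + b * ?Y g"
    if f: "f \<in> smooth_functions N" and g: "g \<in> smooth_functions N" for f g a b
  proof -
    \<comment> \<open>\<open>F\<close> maps points of \<open>M\<close> to points of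
      \<open>N\<close>, so the inner restriction never yields \<open>undefined\<close>.\<close>
    have "(\<lambda>x\<in>points M. (\<lambda>x\<in>points N. a * f x + b * g x) (F x)) =
        (\<lambda>x\<in>points M. a * (\<lambda>x\<in>points M. f (F x)) x + b * (\<lambda>x\<in>points M. g (F x)) x)"
      using smooth_map_points[OF F] by auto
    then show ?thesis
      using Xlin[OF pull[OF f] pull[OF g]] smooth_functions_linear_combination[OF N f g] f g
      by (simp only: restrict_apply' if_True)
  qed
  have prod: "?Y (\<lambda>x\<in>points N. f x * g x) = f (F p) * ?Y g + g (F p) * ?Y f"
    if f: "f \<in> smooth_functions N" and g: "g \<in> smooth_functions N" for f g
  proof -
    have "(\<lambda>x\<in>points M. (\<lambda>x\<in>points N. f x * g x) (F x)) =
        (\<lambda>x\<in>points M. (\<lambda>x\<in>points M. f (F x)) x * (\<lambda>x\<in>points M. g (F x)) x)"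
      using smooth_map_points[OF F] by auto
    then show ?thesis
      using Xprod[OF pull[OF f] pull[OF g]] smooth_functions_mult[OF N f g] f g p
      by (simp only: restrict_apply' if_True)
  qed
  have "?Y \<in> tangent_space N (F p)"
    unfolding tangent_space_def using lin prod by blast
  then show ?thesis
    using smooth_map_points[OF F p] by (simp add: w_eq tangent_map_def tangent_bundle_def)
qed

text \<open>Pullbacks along \<open>K\<close> are smooth on \<open>N\<close>, so the intermediate
  functional is evaluated inside its domain.\<close>

lemma tangent_map_compose:
  assumes M: "smooth_manifold M" and N: "smooth_manifold N" and P: "smooth_manifold P"
    and F: "smooth_map M N F" and K: "smooth_map N P K"
  shows "tangent_map N P K (tangent_map M N F w) = tangent_map M P (\<lambda>x. K (F x)) w"
proof -
  obtain p X where w: "w = (p, X)" by fastforce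
  have "(\<lambda>x\<in>points M. (\<lambda>x\<in>points N. f (K x)) (F x)) = (\<lambda>x\<in>points M. f (K (F x)))" for f :: "_ \<Rightarrow> real"
    using smooth_map_points[OF F] by auto
  then show ?thesis
    using smooth_functions_pullback[OF N P K] by (auto simp: w tangent_map_def cong: restrict_cong)
qed

text \<open>Extensionality of functions and functionals yields true equality although
  \<open>F\<close> is the identity only on the points of \<open>M\<close>, as happens for
  \<open>\<Phi> g\<close> followed by its inverse.\<close>

lemma tangent_map_ident:
  assumes "w \<in> tangent_bundle M" "\<And>x. x \<in> points M \<Longrightarrow> F x = x"
  shows "tangent_map M M F w = w"
proof -
  obtain p X where w: "w = (p, X)" "p \<in> points M" "X \<in> extensional (smooth_functions M)"
    using assms(1) by (auto simp: tangent_bundle_def tangent_space_def)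
  have "(\<lambda>x\<in>points M. f (F x)) = f" if "f \<in> smooth_functions M" for f
    using that assms(2) by (auto simp: smooth_functions_def extensional_def)
  then show ?thesis
    using w assms(2) by (auto simp: tangent_map_def extensional_def)
qed

section \<open>Invariance of the discrete Lagrangian\<close>

lemma lie_group_action_smooth_map:
  assumes "lie_group G M" "smooth_manifold Q" "lie_group_action G M Q \<Phi>" "g \<in> carrier G"
  shows "smooth_map Q Q (\<Phi> g)"
  using assms
  by (simp add: lie_group_def lie_group_action_def smooth_map_slice[where M = M and F = \<Phi>])

lemma lie_group_action_tangent_inverse:
  assumes "lie_group G M" "smooth_manifold Q" "lie_group_action G M Q \<Phi>" "g \<in> carrier G"
    and "w \<in> tangent_bundle Q"
  shows "tangent_map Q Q (\<Phi> (inv\<^bsub>G\<^esub> g)) (tangent_map Q Q (\<Phi> g) w) = w"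
proof -
  interpret group_action G "points Q" \<Phi>
    using assms(3) by (simp add: lie_group_action_def)
  interpret group G
    using assms(1) by (simp add: lie_group_def)
  have "\<Phi> (inv\<^bsub>G\<^esub> g) (\<Phi> g x) = x" if "x \<in> points Q" for x
    using orbit_sym_aux[OF assms(4) that] by simp
  then show ?thesis
    using assms
    by (simp add: tangent_map_compose[OF assms(2) assms(2) assms(2)] lie_group_action_smooth_map
        tangent_map_ident)
qed

text \<open>Equivariance carries the recursion over step by step; it is available because all step
  sizes lie in \<open>H\<close>. The restriction to \<open>{..n}\<close> keeps the translated
  sequence extensional.\<close>

lemma shooting_solution_translate:
  assumes "lie_group G M" "smooth_manifold Q" "lie_group_action G M Q \<Phi>"
    and "equivariant_method G Q \<Phi> H \<Psi>" "g \<in> carrier G"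
    and "\<forall>i<n. (c (Suc i) - c i) * h \<in> H"
    and w: "shooting_solution Q \<Psi> n c q0 q1 h w"
  shows "shooting_solution Q \<Psi> n c (\<Phi> g q0) (\<Phi> g q1) h (\<lambda>i\<in>{..n}. tangent_map Q Q (\<Phi> g) (w i))"
proof -
  have wi: "w i \<in> tangent_bundle Q" if "i \<le> n" for i
    using w that by (auto simp: shooting_solution_def)
  then have "tangent_map Q Q (\<Phi> g) (w i) \<in> tangent_bundle Q" if "i \<le> n" for i
    using that assms
    by (intro tangent_map_in_tangent_bundle lie_group_action_smooth_map) auto
  moreover have "fst (tangent_map Q Q (\<Phi> g) (w i)) = \<Phi> g (fst (w i))" for i
    by (simp add: tangent_map_def split_beta)
  moreover have "tangent_map Q Q (\<Phi> g) (w (Suc i)) =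
      \<Psi> ((c (Suc i) - c i) * h) (tangent_map Q Q (\<Phi> g) (w i))" if "i < n" for i
    using that assms(4-6) w wi[of i] by (simp add: shooting_solution_def equivariant_method_def)
  ultimately show ?thesis
    using w by (auto simp: shooting_solution_def)
qed

theorem proposition4:
  fixes G :: "'g monoid"
    and M :: "('g, 'd::real_inner) manifold"
    and Q :: "('q, 'e::real_inner) manifold"
    and \<Phi> :: "'g \<Rightarrow> 'q \<Rightarrow> 'q"
    and H :: "real set"
    and \<Psi> :: "real \<Rightarrow> 'q tangent_vector \<Rightarrow> 'q tangent_vector"
    and L :: "'q tangent_vector \<Rightarrow> real"
    and n :: nat
    and b c :: "nat \<Rightarrow> real"
    and q0 q1 :: 'q
    and h :: real
  assumes "lie_group G M"
    and "smooth_manifold Q"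
    and "lie_group_action G M Q \<Phi>"
    and "one_step_method Q H \<Psi>"
    and "equivariant_method G Q \<Phi> H \<Psi>"
    and "invariant_lagrangian G Q \<Phi> L"
    and "c 0 = 0" and "c n = 1" and "strict_mono_on {0..n} c"
    and "\<forall>i<n. (c (Suc i) - c i) * h \<in> H"
    and "q0 \<in> points Q" and "q1 \<in> points Q"
    and "\<exists>!w. shooting_solution Q \<Psi> n c q0 q1 h w"
  shows "\<forall>g\<in>carrier G.
    discrete_lagrangian Q \<Psi> L n b c (\<Phi> g q0) (\<Phi> g q1) h = discrete_lagrangian Q \<Psi> L n b c q0 q1 h"
proof
  fix g assume g: "g \<in> carrier G"
  interpret group G
    using assms(1) by (simp add: lie_group_def)
  interpret group_action G "points Q" \<Phi>
    using assms(3) by (simp add: lie_group_action_def)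
  let ?sol = "shooting_solution Q \<Psi> n c" and ?T = "\<lambda>g. tangent_map Q Q (\<Phi> g)"
  have inv_g: "inv\<^bsub>G\<^esub> g \<in> carrier G"
    using g by simp
  note translate = shooting_solution_translate[OF assms(1-3,5) _ assms(10)]
  note tangent_inverse = lie_group_action_tangent_inverse[OF assms(1-3)]
  obtain w where w: "?sol q0 q1 h w"
    using assms(13) by blast
  have uniq: "u = w" if "?sol q0 q1 h u" for u
    using assms(13) that w by blast
  let ?w = "\<lambda>i\<in>{..n}. ?T g (w i)"
  have sol: "?sol (\<Phi> g q0) (\<Phi> g q1) h ?w"
    using translate[OF g w] .
  \<comment> \<open>Unique solvability is assumed only for the endpoints \<open>q0\<close> and
    \<open>q1\<close>; at the translated endpoints it must be derived before \<open>THE\<close> can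
    be evaluated.\<close>
  have "u = ?w" if u: "?sol (\<Phi> g q0) (\<Phi> g q1) h u" for u
  proof
    fix i
    have "\<Phi> (inv\<^bsub>G\<^esub> g) (\<Phi> g q0) = q0" "\<Phi> (inv\<^bsub>G\<^esub> g) (\<Phi> g q1) = q1"
      using orbit_sym_aux g assms(11,12) by blast+
    \<comment> \<open>Translating \<open>u\<close> back by the inverse of \<open>g\<close> solves
      the original problem, whose only solution is \<open>w\<close>.\<close>
    then have "(\<lambda>i\<in>{..n}. ?T (inv\<^bsub>G\<^esub> g) (u i)) = w"
      using translate[OF inv_g u] uniq by simp
    then have "w i = ?T (inv\<^bsub>G\<^esub> g) (u i)" if "i \<le> n" for i
      using that by (metis atMost_iff restrict_apply')
    moreover have "u i \<in> tangent_bundle Q" if "i \<le> n" for i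
      using u that by (auto simp: shooting_solution_def)
    \<comment> \<open>For \<open>i \<le> n\<close> the tangent inverse is taken at the inverse of
      \<open>g\<close>, whose own inverse is \<open>g\<close>; beyond \<open>n\<close> both
      sequences are \<open>undefined\<close>.\<close>
    ultimately show "u i = ?w i"
      using u tangent_inverse[OF inv_g, of "u i"] g
      by (cases "i \<le> n") (auto simp: shooting_solution_def PiE_def extensional_def)
  qed
  with sol have "(THE u. ?sol (\<Phi> g q0) (\<Phi> g q1) h u) = ?w"
    by (rule the_equality)
  moreover have "(THE u. ?sol q0 q1 h u) = w"
    using w uniq by (rule the_equality)
  moreover have "L (?T g (w i)) = L (w i)" if "i \<le> n" for i
    using that w assms(6) g by (auto simp: shooting_solution_def invariant_lagrangian_def)
  ultimately show "discrete_lagrangian Q \<Psi> L n b c (\<Phi> g q0) (\<Phi> g q1) h =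
      discrete_lagrangian Q \<Psi> L n b c q0 q1 h"
    by (simp add: discrete_lagrangian_def)
qed

end
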